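(* Let $K$ be a field of characteristic $\neq 2$ and let $\mathcal{E}$ be a power-associative evolution $K$-algebra which is not nil. Let $\mathcal{E}=Ku_1\oplus Ku_2\oplus\cdots\oplus Ku_s\oplus N$ be its Wedderburn decomposition (direct sum of algebras, with $s\ge 1$, $u_1,\dots,u_s$ nonzero pairwise orthogonal idempotents, and $N$ the nil radical of $\mathcal{E}$). Then $\mathfrak{D}(\mathcal{E})=\mathfrak{D}(N)$, where a derivation of $N$ is identified with the linear map on $\mathcal{E}$ that extends it by $0$ on $Ku_1\oplus\cdots\oplus Ku_s$. That is, every derivation of $\mathcal{E}$ vanishes on $Ku_1\oplus\cdots\oplus Ku_s$ and maps $N$ into $N$, and restriction to $N$ identifies $\mathfrak{D}(\mathcal{E})$ with $\mathfrak{D}(N)$.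
   Context: An evolution $K$-algebra is a finite-dimensional commutative (not necessarily associative) $K$-algebra having a basis $\{e_1,\dots,e_n\}$ (a natural basis) with $e_ie_j=0$ for $i\ne j$. An algebra is power-associative if every subalgebra generated by one element is associative. It is nil if for every element $a$ some principal power $a^{m}$ is $0$, where $a^1=a$, $a^{k+1}=a^ka$. A derivation of an algebra $A$ is a linear map $d:A\to A$ with $d(uv)=ud(v)+d(u)v$ for all $u,v$; $\mathfrak{D}(A)$ is the Lie algebra of all derivations of $A$ under $[d,d']=d\circ d'-d'\circ d$. Known fact (Wedderburn decomposition, from earlier work): if $\mathcal{E}$ is a power-associative evolution algebra over a field of characteristic $\ne 2$ that is not nil, then $\mathcal{E}=Ku_1\oplus\cdots\oplus Ku_s\oplus N$, a direct sum of algebras (so products between different summands vanish), where $s\geq 1$, the $u_i$ are nonzero pairwise orthogonal idempotents, and $N$ is either $0$ or a power-associative nil evolution algebra; $N$ is the nil radical of $\mathcal{E}$. *)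

theory Defs
  imports Complex_Main "HOL-Library.FuncSet"
begin

text \<open>
  A not necessarily associative algebra over a field. The ambient algebra is the whole type;
  notions that also apply to a subalgebra take its underlying set as an argument, so that the
  ambient algebra is addressed by \<^term>\<open>UNIV\<close>.
\<close>

locale nonassoc_algebra = vector_space scale
  for scale :: "'k::field \<Rightarrow> 'v::ab_group_add \<Rightarrow> 'v" (infixr \<open>*s\<close> 75) +
  fixes mult :: "'v \<Rightarrow> 'v \<Rightarrow> 'v" (infixl \<open>\<cdot>\<close> 70)
  assumes mult_add_left: "(x + y) \<cdot> z = x \<cdot> z + y \<cdot> z"
    and mult_add_right: "x \<cdot> (y + z) = x \<cdot> y + x \<cdot> z"
    and mult_scale_left: "(c *s x) \<cdot> y = c *s (x \<cdot> y)"
    and mult_scale_right: "x \<cdot> (c *s y) = c *s (x \<cdot> y)"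
begin

definition subalgebra :: "'v set \<Rightarrow> bool" where
  "subalgebra A \<longleftrightarrow> subspace A \<and> (\<forall>x\<in>A. \<forall>y\<in>A. x \<cdot> y \<in> A)"

definition ideal :: "'v set \<Rightarrow> bool" where
  "ideal I \<longleftrightarrow> subspace I \<and> (\<forall>x\<in>I. \<forall>y. x \<cdot> y \<in> I \<and> y \<cdot> x \<in> I)"

definition natural_basis :: "'v set \<Rightarrow> 'v set \<Rightarrow> bool" where
  "natural_basis A B \<longleftrightarrow> finite B \<and> independent B \<and> span B = A \<and>
     (\<forall>e\<in>B. \<forall>f\<in>B. e \<noteq> f \<longrightarrow> e \<cdot> f = 0)"

definition evolution_algebra :: "'v set \<Rightarrow> bool" where
  "evolution_algebra A \<longleftrightarrow> subalgebra A \<and> (\<forall>x\<in>A. \<forall>y\<in>A. x \<cdot> y = y \<cdot> x) \<and>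
     (\<exists>B. natural_basis A B)"

definition associative_algebra :: "'v set \<Rightarrow> bool" where
  "associative_algebra A \<longleftrightarrow> (\<forall>x\<in>A. \<forall>y\<in>A. \<forall>z\<in>A. (x \<cdot> y) \<cdot> z = x \<cdot> (y \<cdot> z))"

text \<open>
  For \<open>a\<close> in a subalgebra \<open>A\<close>, the hull below is contained in \<open>A\<close>, hence it is also the
  subalgebra of \<open>A\<close> generated by \<open>a\<close>.
\<close>

definition power_associative :: "'v set \<Rightarrow> bool" where
  "power_associative A \<longleftrightarrow> (\<forall>a\<in>A. associative_algebra (subalgebra hull {a}))"

text \<open>
  Only exponents \<open>m \<ge> 1\<close> are meaningful: the first power of \<open>a\<close> is \<open>a\<close>, and each further power
  arises by multiplying with \<open>a\<close> on the right.
\<close>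

definition principal_power :: "'v \<Rightarrow> nat \<Rightarrow> 'v" where
  "principal_power a m = ((\<lambda>x. x \<cdot> a) ^^ (m - 1)) a"

definition nil_algebra :: "'v set \<Rightarrow> bool" where
  "nil_algebra A \<longleftrightarrow> (\<forall>a\<in>A. \<exists>m\<ge>1. principal_power a m = 0)"

definition is_nil_radical :: "'v set \<Rightarrow> bool" where
  "is_nil_radical N \<longleftrightarrow> ideal N \<and> nil_algebra N \<and> (\<forall>I. ideal I \<and> nil_algebra I \<longrightarrow> I \<subseteq> N)"

definition direct_sum_of_algebras :: "'i set \<Rightarrow> ('i \<Rightarrow> 'v set) \<Rightarrow> bool" where
  "direct_sum_of_algebras J W \<longleftrightarrow>
     (\<forall>j\<in>J. subalgebra (W j)) \<and>
     (\<forall>v. \<exists>!w. w \<in> (\<Pi>\<^sub>E j\<in>J. W j) \<and> v = (\<Sum>j\<in>J. w j)) \<and>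
     (\<forall>i\<in>J. \<forall>j\<in>J. i \<noteq> j \<longrightarrow> (\<forall>x\<in>W i. \<forall>y\<in>W j. x \<cdot> y = 0))"

text \<open>
  The summands are indexed by \<open>{0..s}\<close>: index \<open>0\<close> stands for \<open>N\<close>, and \<open>i \<ge> 1\<close> for the line
  spanned by \<open>u i\<close>. Values of \<open>u\<close> outside \<open>{1..s}\<close> are irrelevant.
\<close>

definition wedderburn_decomposition :: "nat \<Rightarrow> (nat \<Rightarrow> 'v) \<Rightarrow> 'v set \<Rightarrow> bool" where
  "wedderburn_decomposition s u N \<longleftrightarrow>
     s \<ge> 1 \<and>
     (\<forall>i\<in>{1..s}. u i \<noteq> 0 \<and> u i \<cdot> u i = u i) \<and>
     (\<forall>i\<in>{1..s}. \<forall>j\<in>{1..s}. i \<noteq> j \<longrightarrow> u i \<cdot> u j = 0) \<and>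
     direct_sum_of_algebras {0..s} (\<lambda>i. if i = 0 then N else span {u i}) \<and>
     (N = {0} \<or> (evolution_algebra N \<and> power_associative N \<and> nil_algebra N)) \<and>
     is_nil_radical N"

text \<open>
  Maps on a subalgebra \<open>A\<close> are represented extensionally, so that each derivation of \<open>A\<close> is
  represented by exactly one element of \<open>derivations A\<close>.
\<close>

definition derivations :: "'v set \<Rightarrow> ('v \<Rightarrow> 'v) set" where
  "derivations A = {d \<in> A \<rightarrow>\<^sub>E A.
     (\<forall>x\<in>A. \<forall>y\<in>A. d (x + y) = d x + d y) \<and>
     (\<forall>c. \<forall>x\<in>A. d (c *s x) = c *s d x) \<and>
     (\<forall>x\<in>A. \<forall>y\<in>A. d (x \<cdot> y) = x \<cdot> d y + d x \<cdot> y)}"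

definition der_add :: "'v set \<Rightarrow> ('v \<Rightarrow> 'v) \<Rightarrow> ('v \<Rightarrow> 'v) \<Rightarrow> 'v \<Rightarrow> 'v" where
  "der_add A d d' = (\<lambda>x\<in>A. d x + d' x)"

definition der_scale :: "'v set \<Rightarrow> 'k \<Rightarrow> ('v \<Rightarrow> 'v) \<Rightarrow> 'v \<Rightarrow> 'v" where
  "der_scale A c d = (\<lambda>x\<in>A. c *s d x)"

definition der_bracket :: "'v set \<Rightarrow> ('v \<Rightarrow> 'v) \<Rightarrow> ('v \<Rightarrow> 'v) \<Rightarrow> 'v \<Rightarrow> 'v" where
  "der_bracket A d d' = (\<lambda>x\<in>A. d (d' x) - d' (d x))"

definition derivation_algebra_iso ::
  "'v set \<Rightarrow> 'v set \<Rightarrow> (('v \<Rightarrow> 'v) \<Rightarrow> 'v \<Rightarrow> 'v) \<Rightarrow> bool" where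
  "derivation_algebra_iso A B \<phi> \<longleftrightarrow>
     bij_betw \<phi> (derivations A) (derivations B) \<and>
     (\<forall>d\<in>derivations A. \<forall>d'\<in>derivations A. \<phi> (der_add A d d') = der_add B (\<phi> d) (\<phi> d')) \<and>
     (\<forall>c. \<forall>d\<in>derivations A. \<phi> (der_scale A c d) = der_scale B c (\<phi> d)) \<and>
     (\<forall>d\<in>derivations A. \<forall>d'\<in>derivations A.
        \<phi> (der_bracket A d d') = der_bracket B (\<phi> d) (\<phi> d'))"

text \<open>
  If the ambient space is the direct sum of the subspaces \<open>C\<close> and \<open>N\<close>, the description below
  denotes the \<open>N\<close>-component of \<open>v\<close>, so this is the extension of \<open>d\<close> from \<open>N\<close> by zero on \<open>C\<close>.
\<close>

definition extend_by_zero :: "'v set \<Rightarrow> 'v set \<Rightarrow> ('v \<Rightarrow> 'v) \<Rightarrow> 'v \<Rightarrow> 'v" where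
  "extend_by_zero C N d v = d (THE n. n \<in> N \<and> v - n \<in> C)"

end

end

theory Submission
  imports Defs
begin

text \<open>
  Put \<open>e = u\<^sub>1 + \<dots> + u\<^sub>s\<close> and \<open>C = K u\<^sub>1 \<oplus> \<dots> \<oplus> K u\<^sub>s\<close>. Everything rests on two observations.

  Each line \<open>K u\<^sub>i\<close> is a summand, so \<open>u\<^sub>i x\<close> and \<open>x u\<^sub>i\<close> are the same multiple of \<open>u\<^sub>i\<close> for every
  \<open>x\<close>. If \<open>d\<close> is a derivation and \<open>u\<^sub>i d(u\<^sub>i) = l u\<^sub>i\<close>, then \<open>d(u\<^sub>i) = d(u\<^sub>i u\<^sub>i) = 2 l u\<^sub>i\<close>, and
  multiplying by \<open>u\<^sub>i\<close> once more gives \<open>l u\<^sub>i = 2 l u\<^sub>i\<close>, whence \<open>d(u\<^sub>i) = 0\<close>. Thus \<open>d\<close> vanishes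
  on \<open>C\<close>, and in particular \<open>d(e) = 0\<close>.

  The element \<open>e\<close> is a unit for \<open>C\<close> and annihilates \<open>N\<close>, so \<open>N\<close> consists exactly of the \<open>x\<close> with
  \<open>e x = 0\<close>. Applying \<open>d\<close> to \<open>e x = 0\<close> gives \<open>e d(x) = 0\<close>, that is, \<open>d\<close> maps \<open>N\<close> into itself.

  The remaining claims hold for any decomposition \<open>C \<oplus> N\<close> of an algebra into two subalgebras that
  annihilate each other: the projection onto \<open>N\<close> is then an algebra homomorphism, so composing it
  with a derivation of \<open>N\<close> yields a derivation of the whole algebra; restriction to \<open>N\<close> is the
  inverse on those derivations that vanish on \<open>C\<close> and preserve \<open>N\<close>.
\<close>

section \<open>Derivations and idempotents\<close>

context nonassoc_algebra
begin

lemma mult_zero_left [simp]: "0 \<cdot> x = 0"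
  using mult_add_left[of 0 0 x] by simp

lemma mult_zero_right [simp]: "x \<cdot> 0 = 0"
  using mult_add_right[of x 0 0] by simp

lemma mult_sum_right: "x \<cdot> (\<Sum>j\<in>J. f j) = (\<Sum>j\<in>J. x \<cdot> f j)"
  by (induction J rule: infinite_finite_induct) (auto simp: mult_add_right)

lemma mult_sum_left: "(\<Sum>j\<in>J. f j) \<cdot> x = (\<Sum>j\<in>J. f j \<cdot> x)"
  by (induction J rule: infinite_finite_induct) (auto simp: mult_add_left)

lemma span_mult_mem:
  assumes "subspace W" and gen: "\<And>a b. a \<in> A \<Longrightarrow> b \<in> B \<Longrightarrow> a \<cdot> b \<in> W"
    and x: "x \<in> span A" and y: "y \<in> span B"
  shows "x \<cdot> y \<in> W"
proof -
  have "x \<cdot> b \<in> W" if "b \<in> B" for b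
    using x
  proof (induction x rule: span_induct_alt)
    case (step c a x)
    then show ?case
      using assms(1) gen that
      by (simp add: mult_add_left mult_scale_left subspace_add subspace_scale)
  qed (simp add: assms(1) subspace_0)
  with y show ?thesis
  proof (induction y rule: span_induct_alt)
    case (step c b y)
    then show ?case
      using assms(1)
      by (simp add: mult_add_right mult_scale_right subspace_add subspace_scale)
  qed (simp add: assms(1) subspace_0)
qed

lemma derivations_UNIV_iff:
  "d \<in> derivations UNIV \<longleftrightarrow>
     (\<forall>x y. d (x + y) = d x + d y) \<and> (\<forall>c x. d (c *s x) = c *s d x) \<and>
     (\<forall>x y. d (x \<cdot> y) = x \<cdot> d y + d x \<cdot> y)"
  by (auto simp: derivations_def)

lemma derivation_zero: "d \<in> derivations UNIV \<Longrightarrow> d 0 = 0"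
  unfolding derivations_UNIV_iff by (metis add_cancel_right_left)

lemma derivation_span_eq_zero:
  assumes d: "d \<in> derivations UNIV" and "\<And>a. a \<in> A \<Longrightarrow> d a = 0" and x: "x \<in> span A"
  shows "d x = 0"
  using x
proof (induction x rule: span_induct_alt)
  case base
  show ?case using d by (rule derivation_zero)
next
  case (step c a x)
  then show ?case using d assms(2) by (simp add: derivations_UNIV_iff)
qed

text \<open>
  The Leibniz rule gives \<open>d u = 2 l u\<close>; multiplying by \<open>u\<close> gives \<open>l u = 2 l u\<close>.
\<close>

lemma derivation_idempotent_eq_zero:
  assumes d: "d \<in> derivations UNIV" and idem: "u \<cdot> u = u"
    and l: "u \<cdot> d u = l *s u" "d u \<cdot> u = l *s u"
  shows "d u = 0"
proof -
  have "d u = d (u \<cdot> u)" by (simp add: idem)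
  also have "\<dots> = u \<cdot> d u + d u \<cdot> u" using d by (simp only: derivations_UNIV_iff)
  finally have du: "d u = l *s u + l *s u" by (simp add: l)
  then have "u \<cdot> d u = l *s u + l *s u"
    by (simp add: mult_add_right mult_scale_right idem)
  with l have "l *s u = 0" by simp
  with du show ?thesis by simp
qed

end

section \<open>Decompositions into two mutually annihilating subalgebras\<close>

locale algebra_direct_sum = nonassoc_algebra +
  fixes C N :: "'b set"
  assumes subalgebra_C: "subalgebra C" and subalgebra_N: "subalgebra N"
    and mult_C_N: "\<lbrakk>x \<in> C; y \<in> N\<rbrakk> \<Longrightarrow> x \<cdot> y = 0"
    and mult_N_C: "\<lbrakk>x \<in> N; y \<in> C\<rbrakk> \<Longrightarrow> x \<cdot> y = 0"
    and ex_component: "\<exists>n\<in>N. v - n \<in> C"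
    and C_Int_N: "C \<inter> N = {0}"
begin

lemma subspace_C: "subspace C" and subspace_N: "subspace N"
  using subalgebra_C subalgebra_N by (auto simp: subalgebra_def)

text \<open>
  The description is the one that occurs in the extension of a map by zero, so that this extension
  is composition with \<open>proj\<close>.
\<close>

definition proj :: "'b \<Rightarrow> 'b" where
  "proj v = (THE n. n \<in> N \<and> v - n \<in> C)"

lemma extend_by_zero_eq: "extend_by_zero C N d v = d (proj v)"
  by (simp add: extend_by_zero_def proj_def)

lemma component_unique:
  assumes "m \<in> N" "v - m \<in> C" "n \<in> N" "v - n \<in> C"
  shows "m = n"
proof -
  have "m - n \<in> N" using assms subspace_N by (simp add: subspace_diff)
  moreover have "(v - n) - (v - m) \<in> C" using assms subspace_C by (blast intro: subspace_diff)
  ultimately have "m - n \<in> C \<inter> N" by simp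
  then show ?thesis by (simp add: C_Int_N)
qed

lemma proj_eqI: "\<lbrakk>n \<in> N; v - n \<in> C\<rbrakk> \<Longrightarrow> proj v = n"
  unfolding proj_def by (rule the_equality) (auto intro: component_unique)

lemma proj_in_N: "proj v \<in> N" and diff_proj_in_C: "v - proj v \<in> C"
  using ex_component[of v] proj_eqI by auto

lemma proj_N: "x \<in> N \<Longrightarrow> proj x = x"
  by (rule proj_eqI) (simp_all add: subspace_0 subspace_C)

lemma proj_C: "x \<in> C \<Longrightarrow> proj x = 0"
  by (rule proj_eqI) (simp_all add: subspace_0 subspace_N)

lemma proj_add: "proj (x + y) = proj x + proj y"
proof (rule proj_eqI)
  show "proj x + proj y \<in> N" by (simp add: subspace_add subspace_N proj_in_N)
  have "(x - proj x) + (y - proj y) \<in> C"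
    by (intro subspace_add subspace_C diff_proj_in_C)
  then show "x + y - (proj x + proj y) \<in> C" by (simp add: algebra_simps)
qed

lemma proj_scale: "proj (c *s x) = c *s proj x"
proof (rule proj_eqI)
  show "c *s proj x \<in> N" by (simp add: subspace_scale subspace_N proj_in_N)
  have "c *s (x - proj x) \<in> C"
    by (intro subspace_scale subspace_C diff_proj_in_C)
  then show "c *s x - c *s proj x \<in> C" by (simp add: scale_right_diff_distrib)
qed

text \<open>
  The mixed terms of \<open>(c + n) \<cdot> (c' + n')\<close> vanish, so its component in \<open>N\<close> is \<open>n \<cdot> n'\<close>.
\<close>

lemma proj_mult: "proj (x \<cdot> y) = proj x \<cdot> proj y"
proof (rule proj_eqI)
  show "proj x \<cdot> proj y \<in> N"
    using subalgebra_N proj_in_N by (simp add: subalgebra_def)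
  let ?c = "x - proj x" and ?c' = "y - proj y"
  have "x \<cdot> y = (?c + proj x) \<cdot> (?c' + proj y)" by simp
  also have "\<dots> = ?c \<cdot> ?c' + proj x \<cdot> proj y"
    by (simp only: mult_add_left mult_add_right mult_C_N[OF diff_proj_in_C proj_in_N]
        mult_N_C[OF proj_in_N diff_proj_in_C] add_0_left add_0_right)
  finally have "x \<cdot> y - proj x \<cdot> proj y = ?c \<cdot> ?c'" by simp
  also have "\<dots> \<in> C"
    using subalgebra_C diff_proj_in_C by (simp add: subalgebra_def)
  finally show "x \<cdot> y - proj x \<cdot> proj y \<in> C" .
qed

lemma mult_proj_left: "y \<in> N \<Longrightarrow> proj x \<cdot> y = x \<cdot> y"
  using mult_C_N[OF diff_proj_in_C, of y x] mult_add_left[of "x - proj x" "proj x" y] by simp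

lemma mult_proj_right: "y \<in> N \<Longrightarrow> y \<cdot> proj x = y \<cdot> x"
  using mult_N_C[OF _ diff_proj_in_C, of y x] mult_add_right[of y "x - proj x" "proj x"] by simp

lemma extend_by_zero_derivation:
  assumes d: "d \<in> derivations N"
  shows "extend_by_zero C N d \<in> derivations UNIV"
proof -
  have dN: "d (proj x) \<in> N" for x using d proj_in_N by (auto simp: derivations_def)
  have "d (proj x \<cdot> proj y) = proj x \<cdot> d (proj y) + d (proj x) \<cdot> proj y" for x y
    using d proj_in_N by (simp add: derivations_def)
  then have "d (proj x \<cdot> proj y) = x \<cdot> d (proj y) + d (proj x) \<cdot> y" for x y
    by (simp only: mult_proj_left[OF dN] mult_proj_right[OF dN])
  then show ?thesis
    using d proj_in_N
    by (simp add: derivations_UNIV_iff extend_by_zero_eq proj_add proj_scale proj_mult)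
      (simp add: derivations_def)
qed

lemma restrict_extend_by_zero:
  assumes "d \<in> derivations N"
  shows "restrict (extend_by_zero C N d) N = d"
  using assms
  by (auto simp: fun_eq_iff restrict_def extend_by_zero_eq proj_N derivations_def PiE_def
      extensional_def)

lemma restrict_derivation:
  assumes "d \<in> derivations UNIV" "d ` N \<subseteq> N"
  shows "restrict d N \<in> derivations N"
  using assms subalgebra_N
  by (auto simp: derivations_def subalgebra_def subspace_add subspace_scale)

lemma extend_by_zero_restrict:
  assumes d: "d \<in> derivations UNIV" and "\<And>x. x \<in> C \<Longrightarrow> d x = 0"
  shows "extend_by_zero C N (restrict d N) = d"
proof
  fix v
  have "d v = d ((v - proj v) + proj v)" by simp
  also have "\<dots> = d (v - proj v) + d (proj v)" using d by (simp only: derivations_UNIV_iff)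
  finally show "extend_by_zero C N (restrict d N) v = d v"
    by (simp add: extend_by_zero_eq proj_in_N assms(2) diff_proj_in_C)
qed

theorem derivations_eq_derivations_of_summand:
  assumes kill: "\<And>d x. d \<in> derivations UNIV \<Longrightarrow> x \<in> C \<Longrightarrow> d x = 0"
    and pres: "\<And>d. d \<in> derivations UNIV \<Longrightarrow> d ` N \<subseteq> N"
  shows "derivations UNIV = extend_by_zero C N ` derivations N"
    and "derivation_algebra_iso UNIV N (\<lambda>d. restrict d N)"
proof -
  show "derivations UNIV = extend_by_zero C N ` derivations N"
  proof (intro equalityI subsetI)
    fix d assume d: "d \<in> derivations UNIV"
    then have "d = extend_by_zero C N (restrict d N)"
      by (simp add: extend_by_zero_restrict kill)
    with restrict_derivation[OF d pres[OF d]] show "d \<in> extend_by_zero C N ` derivations N"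
      by blast
  qed (auto intro: extend_by_zero_derivation)
  have "bij_betw (\<lambda>d. restrict d N) (derivations UNIV) (derivations N)"
    by (rule bij_betw_byWitness[where f' = "extend_by_zero C N"])
      (auto simp: extend_by_zero_restrict kill restrict_extend_by_zero
        intro: extend_by_zero_derivation restrict_derivation dest: pres)
  moreover have "restrict (der_bracket UNIV d d') N = der_bracket N (restrict d N) (restrict d' N)"
    if "d \<in> derivations UNIV" "d' \<in> derivations UNIV" for d d'
    using pres[OF that(1)] pres[OF that(2)] by (auto simp: der_bracket_def fun_eq_iff)
  ultimately show "derivation_algebra_iso UNIV N (\<lambda>d. restrict d N)"
    by (auto simp: derivation_algebra_iso_def der_add_def der_scale_def fun_eq_iff)
qed

end

section \<open>The Wedderburn decomposition\<close>

context nonassoc_algebra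
begin

lemma wedderburn_decompositionD:
  assumes "wedderburn_decomposition s u N"
  shows "i \<in> {1..s} \<Longrightarrow> u i \<cdot> u i = u i"
    and "\<lbrakk>i \<in> {1..s}; j \<in> {1..s}; i \<noteq> j\<rbrakk> \<Longrightarrow> u i \<cdot> u j = 0"
    and "subalgebra N"
    and "\<lbrakk>i \<in> {1..s}; n \<in> N\<rbrakk> \<Longrightarrow> u i \<cdot> n = 0"
    and "\<lbrakk>i \<in> {1..s}; n \<in> N\<rbrakk> \<Longrightarrow> n \<cdot> u i = 0"
    and "\<exists>n\<in>N. v - n \<in> span (u ` {1..s})"
proof -
  let ?W = "\<lambda>i. if i = 0 then N else span {u i}"
  have sum: "direct_sum_of_algebras {0..s} ?W"
    using assms by (simp add: wedderburn_decomposition_def)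
  show "u i \<cdot> u i = u i" if "i \<in> {1..s}"
    using assms that by (simp add: wedderburn_decomposition_def)
  show "u i \<cdot> u j = 0" if "i \<in> {1..s}" "j \<in> {1..s}" "i \<noteq> j"
    using assms that by (simp add: wedderburn_decomposition_def)
  have "\<forall>j\<in>{0..s}. subalgebra (?W j)"
    using sum unfolding direct_sum_of_algebras_def by (rule conjunct1)
  then have "subalgebra (?W 0)" by (rule bspec) simp
  then show "subalgebra N" by simp
  have orth: "x \<cdot> y = 0" if "i \<in> {0..s}" "j \<in> {0..s}" "i \<noteq> j" "x \<in> ?W i" "y \<in> ?W j" for i j x y
    using sum that unfolding direct_sum_of_algebras_def by blast
  show "u i \<cdot> n = 0" if "i \<in> {1..s}" "n \<in> N"
    using orth[of i 0 "u i" n] that by (simp add: span_base)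
  show "n \<cdot> u i = 0" if "i \<in> {1..s}" "n \<in> N"
    using orth[of 0 i n "u i"] that by (simp add: span_base)
  obtain w where w: "w \<in> (\<Pi>\<^sub>E j\<in>{0..s}. ?W j)" and v: "v = (\<Sum>j\<in>{0..s}. w j)"
    using sum unfolding direct_sum_of_algebras_def by blast
  have mem: "w j \<in> ?W j" if "j \<in> {0..s}" for j
    using w that by (rule PiE_mem)
  have "w j \<in> span (u ` {1..s})" if "j \<in> {1..s}" for j
    using mem[of j] that span_mono[of "{u j}" "u ` {1..s}"] by auto
  then have "(\<Sum>j\<in>{1..s}. w j) \<in> span (u ` {1..s})" by (rule span_sum)
  moreover have "v - w 0 = (\<Sum>j\<in>{1..s}. w j)"
    by (simp add: v sum.atLeast_Suc_atMost)
  moreover have "w 0 \<in> N" using mem[of 0] by simp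
  ultimately show "\<exists>n\<in>N. v - n \<in> span (u ` {1..s})" by force
qed

text \<open>
  The line \<open>K u i\<close> is an ideal on which left and right multiplication by any element agree, so the
  computation for idempotents applies to \<open>u i\<close>.
\<close>

lemma wedderburn_mult_idempotent:
  assumes wd: "wedderburn_decomposition s u N" and i: "i \<in> {1..s}"
  obtains l where "u i \<cdot> x = l *s u i" and "x \<cdot> u i = l *s u i"
proof -
  note wdD = wedderburn_decompositionD[OF wd]
  have on_span: "\<exists>l. u i \<cdot> y = l *s u i \<and> y \<cdot> u i = l *s u i" if "y \<in> span (u ` {1..s})" for y
    using that
  proof (induction y rule: span_induct_alt)
    case base
    have "u i \<cdot> 0 = 0 *s u i \<and> 0 \<cdot> u i = 0 *s u i" by simp
    then show ?case ..
  next
    case (step c a y)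
    then obtain j l where j: "j \<in> {1..s}" "a = u j"
      and l: "u i \<cdot> y = l *s u i" "y \<cdot> u i = l *s u i" by blast
    have a: "u i \<cdot> a = (if j = i then 1 else 0) *s u i"
      "a \<cdot> u i = (if j = i then 1 else 0) *s u i"
      using j i wdD(1,2) by auto
    have "u i \<cdot> (c *s a + y) = (c * (if j = i then 1 else 0) + l) *s u i \<and>
      (c *s a + y) \<cdot> u i = (c * (if j = i then 1 else 0) + l) *s u i"
      by (simp add: mult_add_left mult_add_right mult_scale_left mult_scale_right a l
          scale_left_distrib)
    then show ?case ..
  qed
  obtain n where n: "n \<in> N" "x - n \<in> span (u ` {1..s})" using wdD(6) by blast
  obtain l where "u i \<cdot> (x - n) = l *s u i" "(x - n) \<cdot> u i = l *s u i"
    using on_span[OF n(2)] by blast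
  moreover have "u i \<cdot> x = u i \<cdot> (x - n)" "x \<cdot> u i = (x - n) \<cdot> u i"
    using mult_add_right[of "u i" "x - n" n] mult_add_left[of "x - n" n "u i"] wdD(4,5) i n(1)
    by simp_all
  ultimately show thesis using that[of l] by simp
qed

lemma wedderburn_unit_left:
  assumes wd: "wedderburn_decomposition s u N" and x: "x \<in> span (u ` {1..s})"
  shows "(\<Sum>j\<in>{1..s}. u j) \<cdot> x = x"
  using x
proof (induction x rule: span_induct_alt)
  case (step c a x)
  then obtain i where i: "i \<in> {1..s}" "a = u i" by blast
  have "(\<Sum>j\<in>{1..s}. u j) \<cdot> u i = (\<Sum>j\<in>{1..s}. if j = i then u i else 0)"
    unfolding mult_sum_left
    using wedderburn_decompositionD(1,2)[OF wd] i by (intro sum.cong) auto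
  also have "\<dots> = u i" using i by simp
  finally show ?case
    using step i by (simp add: mult_add_right mult_scale_right)
qed simp

lemma wedderburn_unit_annihilates_radical:
  assumes wd: "wedderburn_decomposition s u N" and "x \<in> N"
  shows "(\<Sum>j\<in>{1..s}. u j) \<cdot> x = 0"
  unfolding mult_sum_left
  using wedderburn_decompositionD(4)[OF wd] assms(2) by (simp add: sum.neutral)

lemma wedderburn_algebra_direct_sum:
  assumes wd: "wedderburn_decomposition s u N"
  shows "algebra_direct_sum scale mult (span (u ` {1..s})) N"
proof
  note wdD = wedderburn_decompositionD[OF wd]
  let ?C = "span (u ` {1..s})"
  have zero: "subspace {0}" by (simp add: subspace_def)
  have N: "subspace N" using wdD(3) by (simp add: subalgebra_def)
  have "u i \<cdot> u j \<in> ?C" if "i \<in> {1..s}" "j \<in> {1..s}" for i j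
    using wdD(1,2) that by (cases "i = j") (auto intro: span_base span_zero)
  then have "x \<cdot> y \<in> ?C" if "x \<in> ?C" "y \<in> ?C" for x y
    using span_mult_mem[OF subspace_span _ that] by blast
  then show "subalgebra ?C" by (simp add: subalgebra_def)
  show "subalgebra N" by (rule wdD(3))
  show "x \<cdot> y = 0" if "x \<in> ?C" "y \<in> N" for x y
  proof -
    have "x \<cdot> y \<in> {0}"
      by (rule span_mult_mem[OF zero _ that(1) span_base[OF that(2)]]) (use wdD(4) in blast)
    then show ?thesis by simp
  qed
  show "x \<cdot> y = 0" if "x \<in> N" "y \<in> ?C" for x y
  proof -
    have "x \<cdot> y \<in> {0}"
      by (rule span_mult_mem[OF zero _ span_base[OF that(1)] that(2)]) (use wdD(5) in blast)
    then show ?thesis by simp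
  qed
  show "\<exists>n\<in>N. v - n \<in> ?C" for v by (rule wdD(6))
  \<comment> \<open>The sum of the idempotents acts on \<open>C \<inter> N\<close> both as the identity and as zero.\<close>
  have "x = 0" if "x \<in> ?C" "x \<in> N" for x
    using wedderburn_unit_left[OF wd that(1)] wedderburn_unit_annihilates_radical[OF wd that(2)]
    by simp
  then show "?C \<inter> N = {0}" using subspace_0[OF N] span_zero by auto
qed

lemma wedderburn_derivation_zero:
  assumes wd: "wedderburn_decomposition s u N" and d: "d \<in> derivations UNIV"
    and x: "x \<in> span (u ` {1..s})"
  shows "d x = 0"
proof (rule derivation_span_eq_zero[OF d _ x])
  fix a assume "a \<in> u ` {1..s}"
  then obtain i where i: "i \<in> {1..s}" "a = u i" by blast
  obtain l where "u i \<cdot> d (u i) = l *s u i" "d (u i) \<cdot> u i = l *s u i"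
    using wedderburn_mult_idempotent[OF wd i(1)] .
  then show "d a = 0"
    unfolding i(2)
    by (rule derivation_idempotent_eq_zero[OF d wedderburn_decompositionD(1)[OF wd i(1)]])
qed

text \<open>
  Since \<open>N\<close> is the annihilator of the sum \<open>e\<close> of the idempotents and \<open>d e = 0\<close>, differentiating
  \<open>e \<cdot> x = 0\<close> gives \<open>e \<cdot> d x = 0\<close>.
\<close>

lemma wedderburn_derivation_radical:
  assumes wd: "wedderburn_decomposition s u N" and d: "d \<in> derivations UNIV" and x: "x \<in> N"
  shows "d x \<in> N"
proof -
  let ?e = "\<Sum>j\<in>{1..s}. u j"
  have de: "d ?e = 0"
    by (rule wedderburn_derivation_zero[OF wd d]) (auto intro: span_sum span_base)
  have "0 = d (?e \<cdot> x)"
    by (simp only: wedderburn_unit_annihilates_radical[OF wd x] derivation_zero[OF d])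
  also have "\<dots> = ?e \<cdot> d x + d ?e \<cdot> x" using d by (simp only: derivations_UNIV_iff)
  finally have e_dx: "?e \<cdot> d x = 0" by (simp only: de mult_zero_left add_0_right)
  obtain n where n: "n \<in> N" "d x - n \<in> span (u ` {1..s})"
    using wedderburn_decompositionD(6)[OF wd] by blast
  have "d x - n = ?e \<cdot> (d x - n)" by (rule wedderburn_unit_left[OF wd n(2), symmetric])
  also have "\<dots> = ?e \<cdot> (d x - n) + ?e \<cdot> n"
    by (simp only: wedderburn_unit_annihilates_radical[OF wd n(1)] add_0_right)
  also have "\<dots> = ?e \<cdot> d x" by (simp flip: mult_add_right)
  also have "\<dots> = 0" by (rule e_dx)
  finally show ?thesis using n(1) by simp
qed

end

theorem proposition2p0p11:
  fixes scale :: "'k::field \<Rightarrow> 'v::ab_group_add \<Rightarrow> 'v"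
    and mult :: "'v \<Rightarrow> 'v \<Rightarrow> 'v"
    and s :: nat and u :: "nat \<Rightarrow> 'v" and N C :: "'v set"
    and D :: "'v set \<Rightarrow> ('v \<Rightarrow> 'v) set"
  defines "C \<equiv> module.span scale (u ` {1..s})"
    and "D \<equiv> nonassoc_algebra.derivations scale mult"
  assumes "CHAR('k) \<noteq> 2"
    and "nonassoc_algebra scale mult"
    and "nonassoc_algebra.evolution_algebra scale mult UNIV"
    and "nonassoc_algebra.power_associative scale mult UNIV"
    and "\<not> nonassoc_algebra.nil_algebra mult UNIV"
    and "nonassoc_algebra.wedderburn_decomposition scale mult s u N"
  shows "D UNIV = nonassoc_algebra.extend_by_zero C N ` D N
    \<and> (\<forall>d \<in> D UNIV. (\<forall>x\<in>C. d x = 0) \<and> d ` N \<subseteq> N)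
    \<and> nonassoc_algebra.derivation_algebra_iso scale mult UNIV N (\<lambda>d. restrict d N)"
proof -
  interpret nonassoc_algebra scale mult by fact
  note wd = \<open>wedderburn_decomposition s u N\<close>
  interpret algebra_direct_sum scale mult C N
    unfolding C_def by (rule wedderburn_algebra_direct_sum[OF wd])
  have kill: "d x = 0" if "d \<in> derivations UNIV" "x \<in> C" for d x
    using wedderburn_derivation_zero[OF wd] that by (simp add: C_def)
  have pres: "d ` N \<subseteq> N" if "d \<in> derivations UNIV" for d
    using wedderburn_derivation_radical[OF wd] that by blast
  show ?thesis
    unfolding D_def using kill pres derivations_eq_derivations_of_summand by blast
qed

end
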